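(* Let $k\ge1$. For all $n\ge k$, $$N^{12\cdots k}_{13\text{-}2}(n)=C_{n+1-k}.$$
   Context: A permutation $\pi=\pi_1\cdots\pi_n$ of $\{1,\dots,n\}$ contains the generalized pattern $13\text{-}2$ if there are indices $i,j$ with $i+1<j\le n$ such that $\pi_i\pi_{i+1}\pi_j$ is order-isomorphic to $132$; otherwise it avoids it. A permutation $\pi$ begins with a pattern $p=p_1\cdots p_k$ if $n\ge k$ and $\pi_1\cdots\pi_k$ is order-isomorphic to $p$. $N^p_q(n)$ is the number of permutations of $\{1,\dots,n\}$ that avoid $q$ and begin with $p$. $C_m=\frac1{m+1}\binom{2m}{m}$ is the $m$th Catalan number. *)

theory Defs
  imports Complex_Main "HOL-Combinatorics.Multiset_Permutations"
begin

text \<open>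
  A permutation \<open>\<pi>\<^sub>1 \<dots> \<pi>\<^sub>n\<close> of \<open>{1..n}\<close> is the list of its values, i.e. an element of
  \<open>permutations_of_set {1..n}\<close>. List positions count from \<open>0\<close>, so \<open>\<pi>\<^sub>i\<close> is \<open>\<pi> ! (i - 1)\<close>.
\<close>

definition order_isomorphic :: "nat list \<Rightarrow> nat list \<Rightarrow> bool" where
  "order_isomorphic xs ys \<longleftrightarrow>
     length xs = length ys \<and>
     (\<forall>i<length xs. \<forall>j<length xs. xs ! i < xs ! j \<longleftrightarrow> ys ! i < ys ! j)"

definition contains_13_2 :: "nat list \<Rightarrow> bool" where
  "contains_13_2 \<pi> \<longleftrightarrow>
     (\<exists>i j. i + 1 < j \<and> j < length \<pi> \<and> order_isomorphic [\<pi> ! i, \<pi> ! (i + 1), \<pi> ! j] [1, 3, 2])"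

definition begins_with :: "nat list \<Rightarrow> nat list \<Rightarrow> bool" where
  "begins_with \<pi> p \<longleftrightarrow> length p \<le> length \<pi> \<and> order_isomorphic (take (length p) \<pi>) p"

text \<open>
  \<open>N\<^sup>p\<^sub>q(n)\<close>; the generalized pattern \<open>q\<close> is given by the predicate of containing it.
\<close>

definition avoid_begin_count :: "nat list \<Rightarrow> (nat list \<Rightarrow> bool) \<Rightarrow> nat \<Rightarrow> nat" where
  "avoid_begin_count p contains_q n =
     card {\<pi> \<in> permutations_of_set {1..n}. \<not> contains_q \<pi> \<and> begins_with \<pi> p}"

definition catalan :: "nat \<Rightarrow> real" where
  "catalan m = 1 / real (m + 1) * real ((2 * m) choose m)"

end

theory Submission
  imports Defs
begin

text \<open>
  If \<open>\<pi> = a b \<dots>\<close> avoids 13-2 and \<open>a < b\<close>, then no value lies strictly between \<open>a\<close> and \<open>b\<close>. Removing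
  the first letter therefore shows that the number of avoiders of length \<open>m + 1\<close> whose first letter
  has rank \<open>r\<close> (counted from \<open>0\<close>) is a sum over the ranks \<open>s \<le> r\<close> of the second letter among the
  remaining ones, with \<open>s < r\<close> for a descent and \<open>s = r\<close> for an ascent. This is the recursion of the
  ballot numbers. An initial ascent is forced to keep the rank, so each additional letter of the
  increasing prefix only shortens the permutation by one.
\<close>

section \<open>Ranks of letters and the effect of deleting a letter\<close>

definition rank :: "'a::linorder set \<Rightarrow> 'a \<Rightarrow> nat" where
  "rank A a = card {x \<in> A. x < a}"

lemma rank_less_card:
  assumes "finite A" "a \<in> A"
  shows "rank A a < card A"
  unfolding rank_def using assms by (intro psubset_card_mono) auto

lemma rank_strict_mono:
  assumes "finite A" "a \<in> A" "a < b"
  shows "rank A a < rank A b"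
  unfolding rank_def using assms by (intro psubset_card_mono) auto

lemma bij_betw_rank:
  assumes "finite A"
  shows "bij_betw (rank A) A {..<card A}"
proof -
  have inj: "inj_on (rank A) A"
    by (intro inj_onI) (metis assms rank_strict_mono neqE less_irrefl)
  moreover have "rank A ` A \<subseteq> {..<card A}"
    using rank_less_card[OF assms] by auto
  ultimately show ?thesis
    by (simp add: bij_betw_def card_image card_subset_eq)
qed

text \<open>Reindexing along the bijection \<open>rank A\<close> frees the recursions from the
  actual letters: only ranks remain.\<close>

lemma sum_rank:
  assumes "finite A"
  shows "(\<Sum>b | b \<in> A \<and> P (rank A b). f (rank A b)) = (\<Sum>s | s < card A \<and> P s. f s)"
proof (rule sum.reindex_bij_betw)
  show "bij_betw (rank A) {b. b \<in> A \<and> P (rank A b)} {s. s < card A \<and> P s}"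
    using bij_betw_rank[OF assms] by (auto simp: bij_betw_def inj_on_def)
qed

lemma rank_remove_less:
  assumes "finite A" "b \<in> A" "b < a"
  shows "rank (A - {a}) b < rank A a"
  unfolding rank_def using assms by (intro psubset_card_mono) auto

lemma rank_remove_greater:
  assumes "finite A" "a \<in> A" "a < b"
  shows "rank (A - {a}) b = rank A a + card {x \<in> A. a < x \<and> x < b}"
  unfolding rank_def using assms
  by (subst card_Un_disjoint[symmetric]) (auto intro: arg_cong[where f = card])

text \<open>Below \<open>a\<close> the interval is empty and the rank is strictly smaller. Above
  \<open>a\<close>, the loss of \<open>a\<close> itself cancels the usual increment, so the rank
  exceeds that of \<open>a\<close> by exactly the number of letters in between.\<close>

lemma rank_remove_le_iff:
  assumes "finite A" "a \<in> A" "b \<in> A - {a}"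
  shows "rank (A - {a}) b \<le> rank A a \<longleftrightarrow> \<not> (\<exists>c\<in>A. a < c \<and> c < b)"
proof (cases "a < b")
  case True
  then show ?thesis
    using rank_remove_greater[OF assms(1,2) True] assms by (auto simp: card_eq_0_iff)
next
  case False
  then show ?thesis
    using rank_remove_less[of A b a] assms by fastforce
qed

lemma rank_remove_eq_iff:
  assumes "finite A" "a \<in> A" "b \<in> A - {a}"
  shows "rank (A - {a}) b = rank A a \<longleftrightarrow> a < b \<and> \<not> (\<exists>c\<in>A. a < c \<and> c < b)"
proof (cases "a < b")
  case True
  then show ?thesis
    using rank_remove_greater[OF assms(1,2) True] assms by (auto simp: card_eq_0_iff)
next
  case False
  then show ?thesis
    using rank_remove_less[of A b a] assms by fastforce
qed

section \<open>The pattern 13-2 and increasing prefixes\<close>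

lemma order_isomorphic_132: "order_isomorphic [a, b, c] [1, 3, 2] \<longleftrightarrow> a < c \<and> c < b"
  by (auto simp: order_isomorphic_def All_less_Suc numeral_eq_Suc)

lemma contains_13_2_iff:
  "contains_13_2 \<pi> \<longleftrightarrow>
     (\<exists>i j. i + 1 < j \<and> j < length \<pi> \<and> \<pi> ! i < \<pi> ! j \<and> \<pi> ! j < \<pi> ! (i + 1))"
  unfolding contains_13_2_def order_isomorphic_132 by simp

lemma not_contains_13_2_singleton: "\<not> contains_13_2 [a]"
  by (simp add: contains_13_2_iff)

text \<open>An occurrence starting at the first letter must use \<open>a\<close> and
  \<open>b\<close> as its adjacent pair; every other occurrence lies in the tail.\<close>

lemma contains_13_2_Cons_Cons:
  "contains_13_2 (a # b # \<sigma>) \<longleftrightarrow> contains_13_2 (b # \<sigma>) \<or> (\<exists>c\<in>set \<sigma>. a < c \<and> c < b)"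
proof
  assume "contains_13_2 (a # b # \<sigma>)"
  then obtain i j where ij: "i + 1 < j" "j < length (a # b # \<sigma>)"
    "(a # b # \<sigma>) ! i < (a # b # \<sigma>) ! j" "(a # b # \<sigma>) ! j < (a # b # \<sigma>) ! (i + 1)"
    unfolding contains_13_2_iff by blast
  show "contains_13_2 (b # \<sigma>) \<or> (\<exists>c\<in>set \<sigma>. a < c \<and> c < b)"
  proof (cases i)
    case 0
    with ij have "\<sigma> ! (j - 2) \<in> set \<sigma>" "a < \<sigma> ! (j - 2)" "\<sigma> ! (j - 2) < b"
      by (auto simp: nth_Cons' numeral_2_eq_2)
    then show ?thesis by blast
  next
    case (Suc i')
    then have "contains_13_2 (b # \<sigma>)"
      unfolding contains_13_2_iff using ij
      by (intro exI[of _ i'] exI[of _ "j - 1"]) (auto simp: nth_Cons')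
    then show ?thesis ..
  qed
next
  assume "contains_13_2 (b # \<sigma>) \<or> (\<exists>c\<in>set \<sigma>. a < c \<and> c < b)"
  then show "contains_13_2 (a # b # \<sigma>)"
  proof
    assume "contains_13_2 (b # \<sigma>)"
    then obtain i j where "i + 1 < j" "j < length (b # \<sigma>)"
      "(b # \<sigma>) ! i < (b # \<sigma>) ! j" "(b # \<sigma>) ! j < (b # \<sigma>) ! (i + 1)"
      unfolding contains_13_2_iff by blast
    then show ?thesis
      unfolding contains_13_2_iff by (intro exI[of _ "Suc i"] exI[of _ "Suc j"]) auto
  next
    assume "\<exists>c\<in>set \<sigma>. a < c \<and> c < b"
    then obtain l where "l < length \<sigma>" "a < \<sigma> ! l" "\<sigma> ! l < b"
      by (auto simp: in_set_conv_nth)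
    then show ?thesis
      unfolding contains_13_2_iff by (intro exI[of _ 0] exI[of _ "Suc (Suc l)"]) auto
  qed
qed

text \<open>The pattern has entry \<open>i + 1\<close> at position \<open>i\<close>, so comparing
  its entries is comparing positions; trichotomy then upgrades strict increase to an
  equivalence.\<close>

lemma begins_with_upt_iff:
  "begins_with \<pi> [1..<k + 1] \<longleftrightarrow> k \<le> length \<pi> \<and> sorted_wrt (<) (take k \<pi>)"
proof (cases "k \<le> length \<pi>")
  case True
  have "(\<forall>i<k. \<forall>j<k. \<pi> ! i < \<pi> ! j \<longleftrightarrow> i < j) \<longleftrightarrow> (\<forall>i j. i < j \<longrightarrow> j < k \<longrightarrow> \<pi> ! i < \<pi> ! j)"
  proof (rule iffI)
    assume less: "\<forall>i j. i < j \<longrightarrow> j < k \<longrightarrow> \<pi> ! i < \<pi> ! j"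
    have "\<pi> ! i < \<pi> ! j \<longleftrightarrow> i < j" if "i < k" "j < k" for i j
      using less that by (cases i j rule: linorder_cases) (auto dest: less_asym)
    then show "\<forall>i<k. \<forall>j<k. \<pi> ! i < \<pi> ! j \<longleftrightarrow> i < j" by blast
  qed (use less_trans in blast)
  moreover have "order_isomorphic (take k \<pi>) [1..<k + 1] \<longleftrightarrow>
      (\<forall>i<k. \<forall>j<k. \<pi> ! i < \<pi> ! j \<longleftrightarrow> i < j)"
    using True unfolding order_isomorphic_def by (auto simp del: upt_Suc)
  ultimately show ?thesis
    using True by (simp add: begins_with_def sorted_wrt_iff_nth_less del: upt_Suc)
qed (auto simp: begins_with_def)

section \<open>Avoiders with a prescribed first letter\<close>

text \<open>The letters form an arbitrary set \<open>A\<close> because deleting a letter from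
  \<open>{1..n}\<close> need not leave an initial segment.\<close>

definition avoiders_from :: "nat \<Rightarrow> nat set \<Rightarrow> nat \<Rightarrow> nat list set" where
  "avoiders_from k A a =
     {\<pi> \<in> permutations_of_set A. \<not> contains_13_2 \<pi> \<and> sorted_wrt (<) (take k \<pi>) \<and> hd \<pi> = a}"

lemma finite_avoiders_from: "finite (avoiders_from k A a)"
  by (simp add: avoiders_from_def)

lemma Cons_in_permutations_of_set_iff:
  "a # \<sigma> \<in> permutations_of_set A \<longleftrightarrow> a \<in> A \<and> \<sigma> \<in> permutations_of_set (A - {a})"
  by (auto simp: permutations_of_set_def)

text \<open>Classifies by the second letter \<open>b\<close>: prepending \<open>a\<close> can create
  only occurrences that start with the pair \<open>a\<close>, \<open>b\<close>.\<close>

lemma avoiders_from_Suc: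
  assumes "a \<in> A" "A - {a} \<noteq> {}"
  shows "avoiders_from (Suc k) A a =
    (\<Union>b\<in>{b \<in> A - {a}. \<not> (\<exists>c\<in>A. a < c \<and> c < b) \<and> (k = 0 \<or> a < b)}.
       (#) a ` avoiders_from k (A - {a}) b)" (is "?L = ?R")
proof -
  have Cons_Cons: "a # b # \<sigma> \<in> ?L \<longleftrightarrow> b \<in> A - {a} \<and> \<not> (\<exists>c\<in>A. a < c \<and> c < b) \<and> (k = 0 \<or> a < b) \<and>
      b # \<sigma> \<in> avoiders_from k (A - {a}) b" for b \<sigma>
  proof (cases "b # \<sigma> \<in> permutations_of_set (A - {a})")
    case True
    then have b: "b \<in> A - {a}" "set \<sigma> = A - {a} - {b}"
      by (auto simp: permutations_of_set_def)
    \<comment> \<open>The letters of \<open>A\<close> missing from \<open>\<sigma>\<close> are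
      \<open>a\<close> and \<open>b\<close>, and neither lies strictly between them.\<close>
    then have gap: "(\<exists>c\<in>set \<sigma>. a < c \<and> c < b) \<longleftrightarrow> (\<exists>c\<in>A. a < c \<and> c < b)"
      by auto
    \<comment> \<open>By transitivity \<open>a\<close> need only be compared with \<open>b\<close>;
      for \<open>k = 0\<close> the prefix is \<open>a\<close> alone.\<close>
    have sorted: "sorted_wrt (<) (take (Suc k) (a # b # \<sigma>)) \<longleftrightarrow>
        sorted_wrt (<) (take k (b # \<sigma>)) \<and> (k = 0 \<or> a < b)"
      by (cases k) (auto dest: less_trans)
    have "a # b # \<sigma> \<in> permutations_of_set A"
      using True assms by (simp add: Cons_in_permutations_of_set_iff)
    then show ?thesis
      unfolding avoiders_from_def mem_Collect_eq contains_13_2_Cons_Cons gap sorted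
      using True b(1) by simp blast
  next
    case False
    then show ?thesis
      unfolding avoiders_from_def mem_Collect_eq Cons_in_permutations_of_set_iff[of a] by blast
  qed
  show ?thesis
  proof (intro subset_antisym subsetI)
    fix \<pi>
    assume "\<pi> \<in> ?L"
    then have "set \<pi> = A" "hd \<pi> = a"
      by (auto simp: avoiders_from_def permutations_of_set_def)
    \<comment> \<open>The rule \<open>remdups_adj.cases\<close> splits lists into empty, one letter,
      and at least two letters; \<open>A - {a} \<noteq> {}\<close> excludes the first two.\<close>
    then obtain b \<sigma> where \<pi>: "\<pi> = a # b # \<sigma>"
      using assms by (cases \<pi> rule: remdups_adj.cases) auto
    then show "\<pi> \<in> ?R"
      using \<open>\<pi> \<in> ?L\<close> Cons_Cons[of b \<sigma>] by blast
  next
    fix \<pi>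
    assume "\<pi> \<in> ?R"
    then obtain b \<tau> where b: "b \<in> A - {a}" "\<not> (\<exists>c\<in>A. a < c \<and> c < b)" "k = 0 \<or> a < b"
      and \<tau>: "\<tau> \<in> avoiders_from k (A - {a}) b" "\<pi> = a # \<tau>"
      by blast
    then have "\<tau> = b # tl \<tau>"
      by (cases \<tau>) (auto simp: avoiders_from_def permutations_of_set_def)
    then show "\<pi> \<in> ?L"
      using Cons_Cons[of b "tl \<tau>"] b \<tau> by simp
  qed
qed

lemma card_avoiders_from_Suc:
  assumes "finite A" "a \<in> A" "A - {a} \<noteq> {}"
  shows "card (avoiders_from (Suc k) A a) =
    (\<Sum>b | b \<in> A - {a} \<and> \<not> (\<exists>c\<in>A. a < c \<and> c < b) \<and> (k = 0 \<or> a < b).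
       card (avoiders_from k (A - {a}) b))"
  unfolding avoiders_from_Suc[OF assms(2,3)]
proof (subst card_UN_disjoint, goal_cases)
  \<comment> \<open>Disjointness of the blocks: the letter after \<open>a\<close> determines
    \<open>b\<close>.\<close>
  case 3
  show ?case by (auto simp: avoiders_from_def)
qed (auto simp: assms finite_avoiders_from card_image)

text \<open>A prefix of length at most one is always increasing. This closes the recursion for
  unrestricted avoiders on \<open>k = 1\<close>.\<close>

lemma avoiders_from_0: "avoiders_from 0 A a = avoiders_from 1 A a"
proof -
  have "sorted_wrt (<) (take 1 \<pi>)" for \<pi> :: "nat list"
    by (cases \<pi>) auto
  then show ?thesis by (simp add: avoiders_from_def)
qed

section \<open>Ballot numbers\<close>

text \<open>For \<open>r \<le> m\<close> this is the reflection formula for sequences of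
  \<open>m\<close> up-steps and \<open>r\<close> down-steps that never go below their start. Real
  values keep the subtraction from being truncated.\<close>

definition ballot :: "nat \<Rightarrow> nat \<Rightarrow> real" where
  "ballot m r = real ((m + r) choose m) - real ((m + r) choose Suc m)"

lemma ballot_0_right: "ballot m 0 = 1"
  by (simp add: ballot_def)

lemma ballot_Suc_Suc: "ballot (Suc m) (Suc r) = ballot (Suc m) r + ballot m (Suc r)"
  by (simp add: ballot_def)

text \<open>Iterating the Pascal-type recurrence in \<open>r\<close> gives the same sum as deleting
  the first letter of an avoider.\<close>

lemma ballot_Suc_eq_sum: "ballot (Suc m) r = (\<Sum>s\<le>r. ballot m s)"
  by (induction r) (simp_all add: ballot_0_right ballot_Suc_Suc)

text \<open>Both binomials are the central ones of row \<open>2 * m + 1\<close>. This zero just past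
  the diagonal allows sums to be extended by one term.\<close>

lemma ballot_Suc_right: "ballot m (Suc m) = 0"
  using binomial_symmetric[of m "Suc (m + m)"] by (simp add: ballot_def Suc_diff_le)

text \<open>By absorption the second binomial is \<open>m / (m + 1)\<close> times the first, leaving
  the fraction \<open>1 / (m + 1)\<close> of it.\<close>

lemma ballot_diagonal: "ballot m m = catalan m"
proof -
  have "Suc m * ((m + m) choose Suc m) = m * ((m + m) choose m)"
    using binomial_absorb_comp[of "m + m" m] binomial_absorption[of m "m + m"]
    by (cases m) (simp_all add: algebra_simps)
  then have "real (Suc m) * real ((m + m) choose Suc m) = real m * real ((m + m) choose m)"
    by (metis of_nat_mult)
  then have "real (Suc m) * ballot m m = real ((m + m) choose m)"
    unfolding ballot_def right_diff_distrib by (simp add: distrib_right)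
  then show ?thesis
    unfolding catalan_def mult_2[symmetric] by (simp add: divide_simps mult.commute)
qed

section \<open>Counting avoiders by the rank of the first letter\<close>

lemma card_avoiders_from_1:
  assumes "finite A" "card A = Suc m" "a \<in> A"
  shows "real (card (avoiders_from 1 A a)) = ballot m (rank A a)"
  using assms
proof (induction m arbitrary: A a)
  case 0
  then have A: "A = {a}" by (auto simp: card_1_singleton_iff)
  have "avoiders_from 1 A a = {[a]}"
    by (auto simp: avoiders_from_def A not_contains_13_2_singleton)
  moreover have "rank A a = 0"
    using rank_less_card[of A a] "0.prems" by simp
  ultimately show ?case by (simp add: ballot_0_right)
next
  case (Suc m)
  let ?B = "A - {a}" and ?r = "rank A a"
  have B: "finite ?B" "card ?B = Suc m" using Suc.prems by auto
  then have "?B \<noteq> {}" by (metis card.empty nat.distinct(1))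
  then have "real (card (avoiders_from 1 A a)) =
      (\<Sum>b | b \<in> ?B \<and> \<not> (\<exists>c\<in>A. a < c \<and> c < b). real (card (avoiders_from 1 ?B b)))"
    using card_avoiders_from_Suc[of A a 0] Suc.prems by (simp add: avoiders_from_0)
  also have "\<dots> = (\<Sum>b | b \<in> ?B \<and> rank ?B b \<le> ?r. ballot m (rank ?B b))"
  proof (rule sum.cong)
    show "{b. b \<in> ?B \<and> \<not> (\<exists>c\<in>A. a < c \<and> c < b)} = {b. b \<in> ?B \<and> rank ?B b \<le> ?r}"
      using rank_remove_le_iff[of A a] Suc.prems by blast
  qed (use Suc.IH[OF B] in auto)
  also have "\<dots> = (\<Sum>s | s < Suc m \<and> s \<le> ?r. ballot m s)"
    by (rule sum_rank[OF B(1), where P = "\<lambda>s. s \<le> ?r", unfolded B(2)])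
  \<comment> \<open>The bounds differ only if \<open>a\<close> is the maximum, where
    \<open>?r = Suc m\<close>; the extra term is \<open>ballot m (Suc m) = 0\<close>.\<close>
  also have "\<dots> = (\<Sum>s\<le>?r. ballot m s)"
  proof (rule sum.mono_neutral_left)
    have "?r \<le> Suc m" using rank_less_card[of A a] Suc.prems by simp
    then have "s = Suc m" if "s \<le> ?r" "\<not> s < Suc m" for s using that by simp
    then show "\<forall>s\<in>{..?r} - {s. s < Suc m \<and> s \<le> ?r}. ballot m s = 0"
      using ballot_Suc_right by fastforce
  qed auto
  finally show ?case by (simp add: ballot_Suc_eq_sum)
qed

text \<open>Each forced ascent deletes a letter and keeps the rank, until \<open>m + 1\<close>
  letters remain and \<open>card_avoiders_from_1\<close> applies. A rank above \<open>m\<close>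
  leaves too few larger letters for the prefix, hence the value 0.\<close>

lemma card_avoiders_from:
  assumes "finite A" "card A = Suc k + m" "a \<in> A"
  shows "real (card (avoiders_from (Suc k) A a)) = (if rank A a \<le> m then ballot m (rank A a) else 0)"
  using assms
proof (induction k arbitrary: A a)
  case 0
  then show ?case
    using card_avoiders_from_1[of A m a] rank_less_card[of A a] by simp
next
  case (Suc k)
  let ?B = "A - {a}" and ?r = "rank A a"
  let ?f = "\<lambda>s. if s \<le> m then ballot m s else 0"
  have B: "finite ?B" "card ?B = Suc k + m" using Suc.prems by auto
  then have "?B \<noteq> {}" by (metis card.empty add_Suc nat.distinct(1))
  then have "real (card (avoiders_from (Suc (Suc k)) A a)) =
      (\<Sum>b | b \<in> ?B \<and> \<not> (\<exists>c\<in>A. a < c \<and> c < b) \<and> a < b. real (card (avoiders_from (Suc k) ?B b)))"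
    using card_avoiders_from_Suc[of A a "Suc k"] Suc.prems by simp
  also have "\<dots> = (\<Sum>b | b \<in> ?B \<and> rank ?B b = ?r. ?f (rank ?B b))"
  proof (rule sum.cong)
    show "{b. b \<in> ?B \<and> \<not> (\<exists>c\<in>A. a < c \<and> c < b) \<and> a < b} = {b. b \<in> ?B \<and> rank ?B b = ?r}"
      using rank_remove_eq_iff[of A a] Suc.prems by blast
  qed (use Suc.IH[OF B] in auto)
  also have "\<dots> = (\<Sum>s | s < Suc k + m \<and> s = ?r. ?f s)"
    by (rule sum_rank[OF B(1), where P = "\<lambda>s. s = ?r", unfolded B(2)])
  \<comment> \<open>If no letter of rank \<open>?r\<close> remains, then \<open>?r > m\<close>, so
    the empty sum agrees with \<open>?f ?r = 0\<close>.\<close>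
  also have "{s. s < Suc k + m \<and> s = ?r} = (if ?r < Suc k + m then {?r} else {})"
    by auto
  finally show ?case by simp
qed

theorem proposition13:
  fixes k n :: nat
  assumes "k \<ge> 1" and "n \<ge> k"
  shows "real (avoid_begin_count [1..<k + 1] contains_13_2 n) = catalan (n + 1 - k)"
proof -
  define m where "m = n - k"
  obtain k' where k: "k = Suc k'" using assms(1) by (cases k) auto
  have n: "n = Suc k' + m" using assms by (simp add: m_def k)
  let ?A = "{1..n}" and ?f = "\<lambda>s. if s \<le> m then ballot m s else 0"
  have "hd \<pi> \<in> ?A" if "\<pi> \<in> permutations_of_set ?A" for \<pi>
    using that n by (metis hd_in_set permutations_of_setD(1) atLeastatMost_empty_iff2 set_empty
        le_add1 plus_1_eq_Suc add_Suc)
  \<comment> \<open>The permutations are split by first letter, so that the total becomes a sum over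
    all ranks.\<close>
  then have "{\<pi> \<in> permutations_of_set ?A. \<not> contains_13_2 \<pi> \<and> begins_with \<pi> [1..<k + 1]} =
      (\<Union>a\<in>?A. avoiders_from k ?A a)"
    using assms length_finite_permutations_of_set[of _ ?A]
    unfolding begins_with_upt_iff by (auto simp: avoiders_from_def)
  then have "avoid_begin_count [1..<k + 1] contains_13_2 n = (\<Sum>a\<in>?A. card (avoiders_from k ?A a))"
    unfolding avoid_begin_count_def
    by (subst card_UN_disjoint[symmetric]) (auto simp: finite_avoiders_from, auto simp: avoiders_from_def)
  then have "real (avoid_begin_count [1..<k + 1] contains_13_2 n) = (\<Sum>a\<in>?A. ?f (rank ?A a))"
    using card_avoiders_from[of ?A k' m] n k by simp
  also have "\<dots> = (\<Sum>s<n. ?f s)"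
    using bij_betw_rank[of ?A] by (intro sum.reindex_bij_betw) simp
  also have "\<dots> = (\<Sum>s\<le>m. ballot m s)"
    by (rule sum.mono_neutral_cong_right) (auto simp: n)
  \<comment> \<open>Adding the vanishing term \<open>ballot m (Suc m)\<close> completes the sum to
    \<open>ballot (Suc m) (Suc m)\<close>, a diagonal value.\<close>
  also have "\<dots> = (\<Sum>s\<le>Suc m. ballot m s)"
    by (simp add: ballot_Suc_right)
  also have "\<dots> = catalan (Suc m)"
    using ballot_diagonal[of "Suc m"] by (simp only: ballot_Suc_eq_sum)
  finally show ?thesis using assms by (simp add: m_def Suc_diff_le)
qed

end
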